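(* For every real $\alpha$ with $0<\alpha<\frac14$, there exists a positive integer $n$ such that $\alpha n$ is an integer and every red/blue edge-coloring of the Kneser graph $\mathrm{KG}(n,\alpha n)$ contains a monochromatic triangle.
   Context: The Kneser graph $\mathrm{KG}(n,r)$ has as vertex set all $r$-element subsets of $[n]=\{1,\dots,n\}$, two such sets being adjacent if and only if they are disjoint. A monochromatic triangle is a set of three pairwise adjacent vertices whose three connecting edges all have the same color.
   Formalization: The formal statement is for rational α with 0<α<1/4 only; for irrational α (e.g. √2/8) no positive integer n makes αn an integer, so the claim as stated for every real α fails there. *)

theory Defs
  imports Complex_Main "HOL-Library.Ramsey"
begin

definition kneser_verts :: "nat \<Rightarrow> nat \<Rightarrow> nat set set" where
  "kneser_verts n r = [{1..n}]\<^bsup>r\<^esup>"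

(* For r = 0 the only vertex, the empty set, is disjoint from itself and would carry a loop;
   for r > 0 disjoint vertices are distinct, so every edge is a two-element set. *)
definition kneser_edges :: "nat \<Rightarrow> nat \<Rightarrow> nat set set set" where
  "kneser_edges n r =
     {{A, B} | A B. A \<in> kneser_verts n r \<and> B \<in> kneser_verts n r \<and> A \<inter> B = {}}"

datatype colour = Red | Blue

(* An edge-colouring is a total function on sets of vertices; only its values on edges matter. *)
definition monochromatic_triangle ::
  "'v set \<Rightarrow> 'v set set \<Rightarrow> ('v set \<Rightarrow> colour) \<Rightarrow> 'v set \<Rightarrow> bool" where
  "monochromatic_triangle V E c T \<longleftrightarrow>
     T \<subseteq> V \<and> card T = 3 \<and>
     (\<forall>x\<in>T. \<forall>y\<in>T. x \<noteq> y \<longrightarrow> {x, y} \<in> E) \<and>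
     (\<exists>k. \<forall>x\<in>T. \<forall>y\<in>T. x \<noteq> y \<longrightarrow> c {x, y} = k)"

(* The density of a Kneser graph KG(n, alpha n) is rational, because alpha n is an integer
   and n is positive. Hence no irrational alpha can admit such an n. *)
lemma density_rational:
  fixes \<alpha> :: real and n :: nat
  assumes "n > 0" and "\<alpha> * real n \<in> \<int>"
  shows "\<alpha> \<in> \<rat>"
proof -
  have "\<alpha> * real n \<in> \<rat>"
    using assms(2) Ints_subset_Rats by blast
  then have "(\<alpha> * real n) / real n \<in> \<rat>"
    by (intro Rats_divide) simp_all
  then show ?thesis
    using assms(1) by simp
qed

end

theory Submission
  imports Defs "HOL-Library.Disjoint_Sets"
begin

text \<open>
  Fix a vertex \<open>A\<close> of the Kneser graph and colour each neighbour \<open>X\<close> of \<open>A\<close> by the colour of the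
  edge \<open>{A, X}\<close>. If three pairwise disjoint neighbours get the same colour, then either one of the
  edges among them closes a triangle of that colour with \<open>A\<close>, or the three of them span a triangle of
  the other colour. Such neighbours exist by the two-colour case of the Alon--Frankl--Lovasz
  theorem: among the \<open>r\<close>-subsets of a set with at least \<open>t (r + 1) - 1\<close> elements, two-coloured, there
  are \<open>t\<close> disjoint ones of the same colour. Indeed, unless the colouring is constant there are two
  sets of different colours with a union of size \<open>r + 1\<close>; delete the union, apply induction on \<open>t\<close>,
  and add the one of the right colour. The complement of \<open>A\<close> is large enough for \<open>t = 3\<close> as soon as
  \<open>n \<ge> 4 r + 2\<close>.
\<close>

text \<open>Walk from \<open>A\<close> to \<open>B\<close>, exchanging one element at a time;
  somewhere on the way the colour switches, and two consecutive sets share all but one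
  element.\<close>

lemma nsets_colour_change:
  assumes "A \<in> [M]\<^bsup>s\<^esup>" "B \<in> [M]\<^bsup>s\<^esup>" "P A \<noteq> P B"
  shows "\<exists>A' B'. A' \<in> [M]\<^bsup>s\<^esup> \<and> B' \<in> [M]\<^bsup>s\<^esup> \<and> P A' \<noteq> P B' \<and> card (A' \<union> B') = Suc s"
  using assms
proof (induction "card (A - B)" arbitrary: A rule: less_induct)
  case less
  have fin: "finite A" "finite B" and card: "card A = s" "card B = s"
    and sub: "A \<subseteq> M" "B \<subseteq> M"
    using less.prems by (auto simp: nsets_def)
  have "A \<noteq> B" using less.prems by auto
  then have "\<not> A \<subseteq> B" "\<not> B \<subseteq> A"
    using fin card by (metis card_subset_eq)+
  then obtain a b where a: "a \<in> A" "a \<notin> B" and b: "b \<in> B" "b \<notin> A" by blast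
  define A' where "A' = insert b (A - {a})"
  have "card A' = s"
    using a b fin card by (simp add: A'_def del: card_Diff_insert) (metis card_Suc_Diff1)
  then have A': "A' \<in> [M]\<^bsup>s\<^esup>"
    using sub fin b by (auto simp: nsets_def A'_def)
  show ?case
  proof (cases "P A' = P A")
    case True
    \<comment> \<open>No switch yet: \<open>A'\<close> still differs in colour from \<open>B\<close>
      but is closer to it, so the induction goes on from \<open>A'\<close>.\<close>
    have "A' - B = (A - B) - {a}" using b by (auto simp: A'_def)
    then have "card (A' - B) < card (A - B)"
      using a fin by (simp add: card_Diff1_less del: card_Diff_insert)
    from less.hyps[OF this A' less.prems(2)] show ?thesis
      using less.prems(3) True by simp
  next
    case False
    have "A \<union> A' = insert b A" by (auto simp: A'_def)
    then have "card (A \<union> A') = Suc s" using b fin card by simp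
    then show ?thesis
      using less.prems(1) A' False by (intro exI[of _ A] exI[of _ A']) simp
  qed
qed

text \<open>A small \<open>U\<close> that already shows every colour occurring on \<open>M\<close>:
  the union of a bichromatic pair, or any single \<open>s\<close>-set if the colouring is
  constant.\<close>

lemma nsets_two_colour_hitting:
  fixes P :: "'a set \<Rightarrow> bool"
  assumes "finite M" "s \<le> card M"
  shows "\<exists>U\<subseteq>M. card U \<le> Suc s \<and> (\<forall>X\<in>[M]\<^bsup>s\<^esup>. \<exists>A\<in>[U]\<^bsup>s\<^esup>. P A = P X)"
proof (cases "\<exists>A\<in>[M]\<^bsup>s\<^esup>. \<exists>B\<in>[M]\<^bsup>s\<^esup>. P A \<noteq> P B")
  case True
  then obtain A B where AB: "A \<in> [M]\<^bsup>s\<^esup>" "B \<in> [M]\<^bsup>s\<^esup>" "P A \<noteq> P B" "card (A \<union> B) = Suc s"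
    using nsets_colour_change[of _ M s _ P] by blast
  then have "A \<in> [A \<union> B]\<^bsup>s\<^esup>" "B \<in> [A \<union> B]\<^bsup>s\<^esup>" "A \<union> B \<subseteq> M"
    by (auto simp: nsets_def)
  moreover from this AB(3) have "\<exists>C\<in>[A \<union> B]\<^bsup>s\<^esup>. P C = P X" for X
    by (cases "P A = P X") auto
  ultimately show ?thesis using AB(4)
    by (intro exI[of _ "A \<union> B"]) simp
next
  case False
  obtain A where A: "A \<subseteq> M" "card A = s" "finite A"
    using assms obtain_subset_with_card_n by metis
  then have "A \<in> [A]\<^bsup>s\<^esup>" "A \<in> [M]\<^bsup>s\<^esup>" by (auto simp: nsets_def)
  then have "\<forall>X\<in>[M]\<^bsup>s\<^esup>. \<exists>A\<in>[A]\<^bsup>s\<^esup>. P A = P X" using False by blast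
  moreover have "card A \<le> Suc s" using A(2) by simp
  ultimately show ?thesis using A(1) by (intro exI[of _ A] conjI) assumption+
qed

text \<open>Each induction step deletes at most \<open>Suc s\<close> points, matching the drop in
  the size bound; for \<open>t = 1\<close> the bound just says \<open>s \<le> card M\<close>. The
  colour to be matched is known only after the recursive call, so \<open>U\<close> must offer all
  colours.\<close>

lemma monochromatic_disjoint_nsets:
  fixes P :: "'a set \<Rightarrow> bool"
  assumes "finite M" "t * Suc s \<le> Suc (card M)" "0 < s"
  shows "\<exists>F\<subseteq>[M]\<^bsup>s\<^esup>. finite F \<and> card F = t \<and> disjoint F \<and> (\<forall>X\<in>F. \<forall>Y\<in>F. P X = P Y)"
  using assms
proof (induction t arbitrary: M)
  case 0
  show ?case by (rule exI[of _ "{}"]) auto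
next
  case (Suc t)
  have "s \<le> card M" using Suc.prems by simp
  then obtain U where U: "U \<subseteq> M" "card U \<le> Suc s"
    and hit: "\<And>X. X \<in> [M]\<^bsup>s\<^esup> \<Longrightarrow> \<exists>A\<in>[U]\<^bsup>s\<^esup>. P A = P X"
    using nsets_two_colour_hitting[OF Suc.prems(1), of s P] by blast
  have "card (M - U) = card M - card U"
    using U Suc.prems(1) by (meson card_Diff_subset finite_subset)
  then have "t * Suc s \<le> Suc (card (M - U))"
    using U(2) Suc.prems(2) by simp
  then obtain F where F: "F \<subseteq> [M - U]\<^bsup>s\<^esup>" "finite F" "card F = t" "disjoint F"
    and mono: "\<forall>X\<in>F. \<forall>Y\<in>F. P X = P Y"
    using Suc.IH[of "M - U"] Suc.prems by auto
  have FM: "F \<subseteq> [M]\<^bsup>s\<^esup>" using F(1) by (auto simp: nsets_def)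
  have "\<exists>A\<in>[U]\<^bsup>s\<^esup>. \<forall>X\<in>F. P A = P X"
  proof (cases "F = {}")
    case True
    obtain X where "X \<subseteq> M" "card X = s" "finite X"
      using \<open>s \<le> card M\<close> Suc.prems(1) obtain_subset_with_card_n by metis
    then have "X \<in> [M]\<^bsup>s\<^esup>" by (auto simp: nsets_def)
    then show ?thesis using hit True by blast
  next
    case False
    then obtain X where "X \<in> F" by auto
    then show ?thesis using hit[of X] FM mono by blast
  qed
  then obtain A where A: "A \<in> [U]\<^bsup>s\<^esup>" "\<forall>X\<in>F. P A = P X" by auto
  have dis: "A \<inter> X = {}" if "X \<in> F" for X
    using that F(1) A(1) by (auto simp: nsets_def)
  \<comment> \<open>Disjointness from the members of \<open>F\<close> makes \<open>A\<close> a new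
    set only because \<open>A\<close> is nonempty; this is where \<open>0 < s\<close>
    enters.\<close>
  have "A \<noteq> {}" using A(1) Suc.prems(3) by (auto simp: nsets_def)
  then have "A \<notin> F" using dis by blast
  then have "card (insert A F) = Suc t" using F by simp
  moreover have "disjoint (insert A F)"
    using F(4) dis by (auto simp: disjoint_def)
  moreover have "insert A F \<subseteq> [M]\<^bsup>s\<^esup>"
    using FM A(1) U(1) by (auto simp: nsets_def)
  moreover have "\<forall>X\<in>insert A F. \<forall>Y\<in>insert A F. P X = P Y"
    using A(2) mono by blast
  moreover have "finite (insert A F)" using F(2) by simp
  ultimately show ?case
    by (intro exI[of _ "insert A F"] conjI) assumption+
qed

lemma monochromatic_triangleI:
  assumes "X \<in> V" "Y \<in> V" "Z \<in> V" "X \<noteq> Y" "X \<noteq> Z" "Y \<noteq> Z"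
    and "{X, Y} \<in> E" "{X, Z} \<in> E" "{Y, Z} \<in> E"
    and "c {X, Y} = k" "c {X, Z} = k" "c {Y, Z} = k"
  shows "monochromatic_triangle V E c {X, Y, Z}"
proof -
  have "{Y, X} = {X, Y}" "{Z, X} = {X, Z}" "{Z, Y} = {Y, Z}" by auto
  then show ?thesis
    using assms by (simp add: monochromatic_triangle_def)
qed

lemma kneser_monochromatic_triangle:
  assumes "0 < r" "4 * r + 2 \<le> n"
  shows "\<exists>T. monochromatic_triangle (kneser_verts n r) (kneser_edges n r) c T"
proof -
  let ?V = "kneser_verts n r" and ?E = "kneser_edges n r"
  let ?M = "{Suc r..n}"
  have A: "{1..r} \<in> ?V" using assms by (auto simp: kneser_verts_def nsets_def)
  \<comment> \<open>The complement \<open>?M\<close> of the base vertex \<open>{1..r}\<close> has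
    \<open>n - r \<ge> 3 * r + 2\<close> points, exactly the bound for three sets.\<close>
  have "3 * Suc r \<le> Suc (card ?M)" using assms(2) by simp
  then obtain F where F: "F \<subseteq> [?M]\<^bsup>r\<^esup>" "card F = 3" "disjoint F"
    and mono: "\<forall>X\<in>F. \<forall>Y\<in>F. (c {{1..r}, X} = Red) = (c {{1..r}, Y} = Red)"
    using monochromatic_disjoint_nsets[of ?M 3 r "\<lambda>X. c {{1..r}, X} = Red"] assms(1) by blast
  obtain X Y Z where XYZ: "F = {X, Y, Z}" "X \<noteq> Y" "X \<noteq> Z" "Y \<noteq> Z"
    using F(2) by (auto simp: card_3_iff)
  have FV: "W \<in> ?V" "{1..r} \<inter> W = {}" "{1..r} \<noteq> W" if "W \<in> F" for W
  proof -
    have W: "W \<subseteq> ?M" "finite W" "card W = r" using that F(1) by (auto simp: nsets_def)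
    then show "W \<in> ?V" by (auto simp: kneser_verts_def nsets_def)
    show "{1..r} \<inter> W = {}" using W(1) by auto
    then show "{1..r} \<noteq> W" using assms(1) by auto
  qed
  have edge: "{S, T} \<in> ?E" if "S \<in> ?V" "T \<in> ?V" "S \<inter> T = {}" for S T
    using that by (auto simp: kneser_edges_def)
  have V: "X \<in> ?V" "Y \<in> ?V" "Z \<in> ?V" using FV XYZ by auto
  have E: "{X, Y} \<in> ?E" "{X, Z} \<in> ?E" "{Y, Z} \<in> ?E"
    using edge V F(3) XYZ by (auto simp: disjoint_def)
  have AE: "{{1..r}, W} \<in> ?E" if "W \<in> F" for W using edge[OF A FV(1,2)] that by blast
  define k where "k = c {{1..r}, X}"
  have k: "c {{1..r}, W} = k" if "W \<in> F" for W
  proof -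
    have "X \<in> F" using XYZ(1) by simp
    then show ?thesis
      using mono that unfolding k_def by (metis (full_types) colour.exhaust)
  qed
  have closes: ?thesis if "S \<in> F" "T \<in> F" "S \<noteq> T" "{S, T} \<in> ?E" "c {S, T} = k" for S T
    using monochromatic_triangleI[OF A FV(1) FV(1) FV(3) FV(3), of S T ?E c k] AE k that by blast
  show ?thesis
  proof (cases "c {X, Y} = k \<or> c {X, Z} = k \<or> c {Y, Z} = k")
    case True
    then show ?thesis using closes E XYZ by blast
  next
    case False
    then have "c {X, Z} = c {X, Y}" "c {Y, Z} = c {X, Y}"
      by (metis (full_types) colour.exhaust)+
    then show ?thesis
      using monochromatic_triangleI[OF V XYZ(2-4) E, of c "c {X, Y}"] by auto
  qed
qed

text \<open>Rationality of \<open>\<alpha>\<close> is assumed because, by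
  \<open>density_rational\<close>, the conclusion forces it.\<close>

theorem theorem1p6:
  fixes \<alpha> :: real
  assumes "0 < \<alpha>" and "\<alpha> < 1 / 4" and "\<alpha> \<in> \<rat>"
  shows "\<exists>n r :: nat. n > 0 \<and> \<alpha> * real n = real r \<and>
           (\<forall>c :: nat set set \<Rightarrow> colour.
              \<exists>T. monochromatic_triangle (kneser_verts n r) (kneser_edges n r) c T)"
proof -
  obtain p q :: nat where q: "q \<noteq> 0" and "\<bar>\<alpha>\<bar> = real p / real q"
    using Rats_abs_nat_div_natE[OF assms(3)] by metis
  then have \<alpha>: "\<alpha> = real p / real q" using assms(1) by simp
  have "0 < p" using \<alpha> assms(1) by (cases p) auto
  moreover have "real p / real q < 1 / 4" using \<alpha> assms(2) by simp
  then have "real (4 * p) < real q" using q by (simp add: field_simps)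
  then have "4 * p < q" by linarith
  \<comment> \<open>The strict inequality gives a gap of only 1 between \<open>4 * p\<close> and
    \<open>q\<close>; doubling the fraction yields the required gap of 2.\<close>
  then have "4 * (2 * p) + 2 \<le> 2 * q" by simp
  ultimately have "\<exists>T. monochromatic_triangle
      (kneser_verts (2 * q) (2 * p)) (kneser_edges (2 * q) (2 * p)) c T" for c
    by (intro kneser_monochromatic_triangle) auto
  moreover have "\<alpha> * real (2 * q) = real (2 * p)" using \<alpha> q by simp
  ultimately show ?thesis using q by (intro exI[of _ "2 * q"] exI[of _ "2 * p"]) auto
qed

end
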